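(* Let $\mathcal D$ be a non-increasing degree sequence of a simple graph. Then the maximum of $\lambda_1$ over $\mathcal M(\mathcal D)$ is attained at some sink of $G(\mathcal D)$, i.e. at a matrix of $\mathcal M(\mathcal D)$ admitting no positive switch.
   Context: $\mathcal M(\mathcal D)$ is the set of symmetric $n\times n$ $(0,1)$-matrices with zero diagonal and row sums $\mathcal D$. $\lambda_1(\mathbf A)$ is the largest eigenvalue of $\mathbf A$. For pairwise distinct $i,j,k,l$ with $i<j$, $k<l$, $\mathcal C_{ijkl}$ has entries $+1$ at $(i,k),(k,i),(j,l),(l,j)$, $-1$ at $(i,l),(l,i),(j,k),(k,j)$, $0$ elsewhere; a positive switch replaces $\mathbf A$ by $\mathbf A+\mathcal C_{ijkl}$ when this lies in $\mathcal M(\mathcal D)$. $G(\mathcal D)$ is the directed graph on $\mathcal M(\mathcal D)$ with an arc $\mathbf A\to\mathbf A'$ when $\mathbf A'$ is obtained from $\mathbf A$ by one positive switch; a sink is a vertex with no outgoing arc. *)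

theory Defs
  imports "Jordan_Normal_Form.Spectral_Radius" "Graph_Theory.Pair_Digraph"
begin

text \<open>
  The size \<open>n\<close> is \<open>length D\<close>, and rows, columns and vertices are numbered
  \<open>0, \<dots>, n - 1\<close>.
\<close>

text \<open>
  \<^locale>\<open>pair_graph\<close> is a finite, loop-free, symmetric digraph without parallel arcs, that is, a
  finite simple graph with every edge stored as its two opposite arcs; the out-degree of a vertex
  is therefore its degree.
\<close>

definition degree_sequence :: "nat pair_pre_digraph \<Rightarrow> nat list \<Rightarrow> bool" where
  "degree_sequence H D \<longleftrightarrow>
     pverts H = {..<length D} \<and> (\<forall>i<length D. out_degree (with_proj H) i = D ! i)"

definition adjacency_mats :: "nat list \<Rightarrow> real mat set" where
  "adjacency_mats D =
     {A \<in> carrier_mat (length D) (length D).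
        A\<^sup>T = A \<and>
        (\<forall>i<length D. \<forall>j<length D. A $$ (i, j) \<in> {0, 1}) \<and>
        (\<forall>i<length D. A $$ (i, i) = 0) \<and>
        (\<forall>i<length D. (\<Sum>j<length D. A $$ (i, j)) = real (D ! i))}"

text \<open>
  Only used for real symmetric matrices, all of whose eigenvalues are real. For the \<open>0 \<times> 0\<close>
  matrix the spectrum is empty and the value is unspecified.
\<close>

definition lambda1 :: "real mat \<Rightarrow> real" where
  "lambda1 A = Max (spectrum A)"

definition switch_mat :: "nat \<Rightarrow> nat \<Rightarrow> nat \<Rightarrow> nat \<Rightarrow> nat \<Rightarrow> real mat" where
  "switch_mat n i j k l = mat n n (\<lambda>p.
     if p \<in> {(i, k), (k, i), (j, l), (l, j)} then 1
     else if p \<in> {(i, l), (l, i), (j, k), (k, j)} then - 1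
     else 0)"

definition positive_switch :: "nat list \<Rightarrow> real mat \<Rightarrow> real mat \<Rightarrow> bool" where
  "positive_switch D A A' \<longleftrightarrow>
     A \<in> adjacency_mats D \<and> A' \<in> adjacency_mats D \<and>
     (\<exists>i j k l. distinct [i, j, k, l] \<and> {i, j, k, l} \<subseteq> {..<length D} \<and> i < j \<and> k < l \<and>
        A' = A + switch_mat (length D) i j k l)"

definition switch_graph :: "nat list \<Rightarrow> real mat pair_pre_digraph" where
  "switch_graph D =
     \<lparr>pverts = adjacency_mats D, parcs = {(A, A'). positive_switch D A A'}\<rparr>"

definition is_sink :: "'a pair_pre_digraph \<Rightarrow> 'a \<Rightarrow> bool" where
  "is_sink G v \<longleftrightarrow> v \<in> pverts G \<and> out_arcs (with_proj G) v = {}"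

end

theory Submission
  imports Defs "HOL-Analysis.Function_Topology"
begin

text \<open>
  Let \<open>M\<close> maximize \<open>\<lambda>\<^sub>1\<close>, and let \<open>x \<ge> 0\<close> satisfy \<open>x\<^sup>T M x \<ge> \<lambda>\<^sub>1(M) x\<^sup>T x\<close>. If \<open>x\<^sub>i < x\<^sub>j\<close> although
  \<open>i < j\<close>, exchanging the two entries and adapting the matrix within the same degree sequence does
  not decrease the quadratic form, so \<open>x\<close> may be assumed non-increasing. A positive switch then
  changes the form by \<open>2 (x\<^sub>i - x\<^sub>j) (x\<^sub>k - x\<^sub>l) \<ge> 0\<close>, and switching as long as possible ends in a
  sink, whose \<open>\<lambda>\<^sub>1\<close> is at least \<open>\<lambda>\<^sub>1(M)\<close> by Rayleigh's principle.
\<close>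

text \<open>Extremal choices over finite sets replace termination arguments: they give the matrix
  with largest \<open>lambda1\<close>, the sorted vector and the sink.\<close>

lemma finite_maximizer:
  fixes f :: "'a \<Rightarrow> 'b::linorder"
  assumes "finite S" "S \<noteq> {}"
  obtains a where "a \<in> S" "\<And>b. b \<in> S \<Longrightarrow> f b \<le> f a"
proof -
  have "Max (f ` S) \<in> f ` S" using assms by (intro Max_in) auto
  then obtain a where "a \<in> S" "Max (f ` S) = f a" by blast
  with assms(1) that show ?thesis by (metis Max_ge finite_imageI imageI)
qed

section \<open>The bilinear form of a matrix\<close>

text \<open>Vectors are plain functions, of which only the values below the dimensions matter; this
  suits the product topology and composition with permutations.\<close>

definition form :: "real mat \<Rightarrow> (nat \<Rightarrow> real) \<Rightarrow> (nat \<Rightarrow> real) \<Rightarrow> real" where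
  "form A x y = (\<Sum>i<dim_row A. \<Sum>j<dim_col A. A $$ (i, j) * x i * y j)"

lemma form_carrier:
  "A \<in> carrier_mat n m \<Longrightarrow> form A x y = (\<Sum>i<n. \<Sum>j<m. A $$ (i, j) * x i * y j)"
  by (auto simp: form_def)

lemma form_cong:
  assumes "A \<in> carrier_mat n n" "\<And>i. i < n \<Longrightarrow> x i = x' i" "\<And>i. i < n \<Longrightarrow> y i = y' i"
  shows "form A x y = form A x' y'"
  using assms by (auto simp: form_carrier intro!: sum.cong)

lemma form_add_left: "form A (\<lambda>i. x i + t * y i) z = form A x z + t * form A y z"
  by (simp add: form_def sum_distrib_left sum.distrib algebra_simps)

lemma form_add_right: "form A z (\<lambda>i. x i + t * y i) = form A z x + t * form A z y"
  by (simp add: form_def sum_distrib_left sum.distrib algebra_simps)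

lemma form_scale: "form A (\<lambda>i. t * x i) (\<lambda>i. t * x i) = t\<^sup>2 * form A x x"
  by (simp add: form_def sum_distrib_left power2_eq_square algebra_simps)

lemma form_add_mat:
  assumes "A \<in> carrier_mat n m" "B \<in> carrier_mat n m"
  shows "form (A + B) x y = form A x y + form B x y"
  using assms by (simp add: form_def sum.distrib distrib_right)

lemma form_commute:
  assumes A: "A \<in> carrier_mat n n" and sym: "A\<^sup>T = A"
  shows "form A x y = form A y x"
proof -
  have eq: "A $$ (i, j) = A $$ (j, i)" if "i < n" "j < n" for i j
    using arg_cong[OF sym, of "\<lambda>M. M $$ (i, j)"] that A by auto
  have "form A x y = (\<Sum>j<n. \<Sum>i<n. A $$ (i, j) * x i * y j)"
    unfolding form_carrier[OF A] by (rule sum.swap)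
  also have "\<dots> = form A y x"
    unfolding form_carrier[OF A] by (intro sum.cong refl) (simp add: eq)
  finally show ?thesis .
qed

lemma form_mult_mat_vec:
  assumes A: "A \<in> carrier_mat n n" and v: "v \<in> carrier_vec n"
  shows "form A x (\<lambda>i. v $ i) = (\<Sum>i<n. x i * (A *\<^sub>v v) $ i)"
proof -
  have "(A *\<^sub>v v) $ i = (\<Sum>j<n. A $$ (i, j) * v $ j)" if "i < n" for i
    using that A v by (auto simp: scalar_prod_def atLeast0LessThan)
  then show ?thesis
    by (simp add: form_carrier[OF A] sum_distrib_left algebra_simps)
qed

section \<open>Rayleigh's principle for real symmetric matrices\<close>

text \<open>The first-order condition: the polynomial attains its maximum 0 at \<open>t = 0\<close>,
  so its derivative \<open>b\<close> vanishes there.\<close>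

lemma linear_coeff_eq_0:
  fixes b c :: real
  assumes "\<And>t. b * t + c * t\<^sup>2 \<le> 0"
  shows "b = 0"
proof -
  \<comment> \<open>This \<open>m\<close> gives \<open>m + c \<ge> 1\<close>, so at
    \<open>t = b / m\<close> the linear term outweighs the quadratic one.\<close>
  define m where "m = \<bar>c\<bar> + 1"
  have m: "m > 0" "m + c \<ge> 1" by (auto simp: m_def)
  have "b * (b / m) + c * (b / m)\<^sup>2 = b\<^sup>2 * (m + c) / m\<^sup>2"
    using m by (simp add: field_simps power2_eq_square)
  with assms[of "b / m"] have "b\<^sup>2 * (m + c) / m\<^sup>2 \<le> 0" by simp
  then have "b\<^sup>2 * (m + c) \<le> 0"
    using m by (simp add: divide_le_0_iff)
  moreover have "b\<^sup>2 * 1 \<le> b\<^sup>2 * (m + c)"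
    using m by (intro mult_left_mono) auto
  ultimately have "b\<^sup>2 \<le> 0" by linarith
  then show ?thesis by simp
qed

text \<open>Fixing the coordinates from \<open>n\<close> on to 0 makes the sphere a closed subset of
  a product of intervals \<open>[-1, 1]\<close>, which is compact by Tychonoff.\<close>

lemma compact_unit_sphere_fun:
  "compact {f :: nat \<Rightarrow> real. (\<forall>i\<in>{n..}. f i = 0) \<and> (\<Sum>i<n. (f i)\<^sup>2) = 1}" (is "compact ?S")
proof -
  let ?P = "PiE UNIV (\<lambda>i::nat. {-1..1::real})"
  have "compactin (product_topology (\<lambda>i::nat. euclidean :: real topology) UNIV) ?P"
    by (simp add: compactin_PiE)
  then have P: "compact ?P"
    by (simp add: euclidean_product_topology)
  have "?S = (\<Inter>i\<in>{n..}. {f. f i = 0}) \<inter> {f. (\<Sum>i<n. (f i)\<^sup>2) = 1}"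
    by auto
  moreover have "closed \<dots>"
    by (intro closed_Int closed_INT ballI closed_Collect_eq continuous_intros
        continuous_on_product_coordinates)
  ultimately have S: "closed ?S" by simp
  have "?S \<subseteq> ?P"
  proof
    fix f assume f: "f \<in> ?S"
    have "\<bar>f i\<bar> \<le> 1" for i
    proof (cases "i < n")
      case True
      then have "(f i)\<^sup>2 \<le> (\<Sum>i<n. (f i)\<^sup>2)" by (intro member_le_sum) auto
      with f show ?thesis by (simp add: abs_square_le_1)
    next
      case False
      with f show ?thesis by auto
    qed
    then show "f \<in> ?P" by (auto simp: abs_le_iff minus_le_iff)
  qed
  then have "?S = ?P \<inter> ?S" by auto
  with compact_Int_closed[OF P S] show ?thesis by simp
qed

text \<open>The form attains a maximum \<open>\<mu>\<close> on the unit sphere. Homogeneity extends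
  the bound to all vectors, and the first-order condition makes the maximizer an eigenvector for
  \<open>\<mu>\<close>.\<close>

lemma symmetric_max_eigenvalue:
  assumes A: "A \<in> carrier_mat n n" and sym: "A\<^sup>T = A" and n: "0 < n"
  shows "\<exists>\<mu>\<in>spectrum A. \<forall>x. form A x x \<le> \<mu> * (\<Sum>i<n. (x i)\<^sup>2)"
proof -
  let ?S = "{f :: nat \<Rightarrow> real. (\<forall>i\<in>{n..}. f i = 0) \<and> (\<Sum>i<n. (f i)\<^sup>2) = 1}"
  have "(\<lambda>i. of_bool (i = 0)) \<in> ?S" using n by (auto simp: power2_eq_square of_bool_def if_distrib cong: if_cong)
  then have ne: "?S \<noteq> {}" by (rule ex_in_conv[THEN iffD1, OF exI])
  have "continuous_on ?S (\<lambda>f. form A f f)"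
    unfolding form_def
    by (intro continuous_on_sum continuous_on_mult continuous_on_const
        continuous_on_subset[OF continuous_on_product_coordinates subset_UNIV])
  from continuous_attains_sup[OF compact_unit_sphere_fun ne this]
  obtain v where v: "v \<in> ?S" and vmax: "\<And>f. f \<in> ?S \<Longrightarrow> form A f f \<le> form A v v" by blast
  define \<mu> where "\<mu> = form A v v"
  have bound: "form A x x \<le> \<mu> * (\<Sum>i<n. (x i)\<^sup>2)" for x
  proof (cases "(\<Sum>i<n. (x i)\<^sup>2) = 0")
    case True
    then have "x i = 0" if "i < n" for i
      using that by (simp add: sum_nonneg_eq_0_iff)
    then show ?thesis by (simp add: form_carrier[OF A])
  next
    case False
    define s where "s = sqrt (\<Sum>i<n. (x i)\<^sup>2)"
    have s2: "s\<^sup>2 = (\<Sum>i<n. (x i)\<^sup>2)" by (simp add: s_def sum_nonneg)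
    with False have s0: "s \<noteq> 0" by auto
    \<comment> \<open>Besides being normalized, \<open>x\<close> is cut off at \<open>n\<close>, as
      membership in the sphere demands.\<close>
    define f where "f = (\<lambda>i. if i < n then x i / s else 0)"
    have "(\<Sum>i<n. (f i)\<^sup>2) = (\<Sum>i<n. (x i)\<^sup>2) / s\<^sup>2"
      by (simp add: f_def power_divide sum_divide_distrib)
    moreover have "\<dots> = 1" using False by (simp add: s2)
    ultimately have "f \<in> ?S" by (simp add: f_def)
    from vmax[OF this] have "s\<^sup>2 * form A f f \<le> s\<^sup>2 * \<mu>"
      by (simp add: \<mu>_def mult_left_mono)
    moreover have "s\<^sup>2 * form A f f = form A x x"
      unfolding form_scale[symmetric] using s0 by (intro form_cong[OF A]) (auto simp: f_def)
    ultimately show ?thesis by (simp add: s2 mult.commute)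
  qed
  define w where "w = vec n v"
  have w: "w \<in> carrier_vec n" by (simp add: w_def)
  \<comment> \<open>The residual of the eigenvalue equation. Perturbing \<open>v\<close> in the
    direction \<open>r\<close> itself gives a first-order term that is twice the squared norm of
    \<open>r\<close>.\<close>
  define r where "r = (\<lambda>i. (A *\<^sub>v w) $ i - \<mu> * v i)"
  have "2 * (\<Sum>i<n. (r i)\<^sup>2) = 0"
  proof (rule linear_coeff_eq_0)
    fix t :: real
    have "form A r v = form A r (\<lambda>i. w $ i)"
      by (intro form_cong[OF A]) (auto simp: w_def)
    then have rv: "form A r v = (\<Sum>i<n. r i * (A *\<^sub>v w) $ i)"
      by (simp add: form_mult_mat_vec[OF A w])
    have "form A (\<lambda>i. v i + t * r i) (\<lambda>i. v i + t * r i)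
        = \<mu> + 2 * t * form A r v + t\<^sup>2 * form A r r"
      by (simp add: form_add_left form_add_right form_commute[OF A sym, of v r] \<mu>_def
          algebra_simps power2_eq_square)
    moreover have "(v i + t * r i)\<^sup>2 = (v i)\<^sup>2 + 2 * t * (r i * v i) + t\<^sup>2 * (r i)\<^sup>2" for i
      by (simp add: power2_eq_square algebra_simps)
    then have "(\<Sum>i<n. (v i + t * r i)\<^sup>2)
        = (\<Sum>i<n. (v i)\<^sup>2) + 2 * t * (\<Sum>i<n. r i * v i) + t\<^sup>2 * (\<Sum>i<n. (r i)\<^sup>2)"
      by (simp add: sum.distrib flip: sum_distrib_left)
    \<comment> \<open>The terms without \<open>t\<close> cancel, since \<open>v\<close> has norm 1
      and form value \<open>\<mu>\<close>.\<close>
    ultimately have "2 * t * (form A r v - \<mu> * (\<Sum>i<n. r i * v i))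
        + t\<^sup>2 * (form A r r - \<mu> * (\<Sum>i<n. (r i)\<^sup>2)) \<le> 0"
      using bound[of "\<lambda>i. v i + t * r i"] v by (simp add: algebra_simps)
    moreover have "(r i)\<^sup>2 = r i * (A *\<^sub>v w) $ i - \<mu> * (r i * v i)" for i
      by (simp add: r_def power2_eq_square algebra_simps)
    then have "form A r v - \<mu> * (\<Sum>i<n. r i * v i) = (\<Sum>i<n. (r i)\<^sup>2)"
      by (simp add: rv sum_subtractf flip: sum_distrib_left)
    ultimately show "2 * (\<Sum>i<n. (r i)\<^sup>2) * t + (form A r r - \<mu> * (\<Sum>i<n. (r i)\<^sup>2)) * t\<^sup>2 \<le> 0"
      by (simp add: algebra_simps)
  qed
  then have r0: "r i = 0" if "i < n" for i
    using that by (simp add: sum_nonneg_eq_0_iff)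
  have "A *\<^sub>v w = \<mu> \<cdot>\<^sub>v w"
  proof (rule eq_vecI)
    fix i assume "i < dim_vec (\<mu> \<cdot>\<^sub>v w)"
    then have "i < n" by (simp add: w_def)
    with r0[of i] show "(A *\<^sub>v w) $ i = (\<mu> \<cdot>\<^sub>v w) $ i" by (simp add: r_def w_def)
  qed (use A w in auto)
  moreover have "w \<noteq> 0\<^sub>v n"
  proof
    assume w0: "w = 0\<^sub>v n"
    then have "v i = 0" if "i < n" for i
      using that index_vec[OF that, of v] unfolding w_def[symmetric] w0 by simp
    with v show False by simp
  qed
  ultimately have "eigenvector A w \<mu>"
    using A w by (auto simp: eigenvector_def)
  then have "\<mu> \<in> spectrum A"
    unfolding spectrum_def eigenvalue_def by blast
  with bound show ?thesis by blast
qed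

lemma form_le_lambda1:
  assumes A: "A \<in> carrier_mat n n" "A\<^sup>T = A" and n: "0 < n"
  shows "form A x x \<le> lambda1 A * (\<Sum>i<n. (x i)\<^sup>2)"
proof -
  from symmetric_max_eigenvalue[OF assms] obtain \<mu>
    where \<mu>: "\<mu> \<in> spectrum A" "form A x x \<le> \<mu> * (\<Sum>i<n. (x i)\<^sup>2)" by blast
  have "\<mu> \<le> lambda1 A"
    unfolding lambda1_def by (intro Max_ge card_finite_spectrum(1)[OF A(1)] \<mu>)
  then show ?thesis
    using \<mu>(2) by (meson mult_right_mono order_trans sum_nonneg zero_le_power2)
qed

lemma lambda1_eigenvector:
  assumes A: "A \<in> carrier_mat n n" "A\<^sup>T = A" and n: "0 < n"
  obtains v where "eigenvector A v (lambda1 A)"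
proof -
  have "spectrum A \<noteq> {}" using symmetric_max_eigenvalue[OF assms] by blast
  then have "lambda1 A \<in> spectrum A"
    unfolding lambda1_def by (intro Max_in card_finite_spectrum(1)[OF A(1)])
  then show ?thesis using that by (auto simp: spectrum_def eigenvalue_def)
qed

text \<open>Replacing an eigenvector by its entrywise absolute value does not decrease the form of a
  nonnegative matrix, so Perron-Frobenius is not needed.\<close>

lemma nonneg_vector_form_ge_lambda1:
  assumes A: "A \<in> carrier_mat n n" "A\<^sup>T = A" and n: "0 < n"
    and nonneg: "\<And>i j. i < n \<Longrightarrow> j < n \<Longrightarrow> A $$ (i, j) \<ge> 0"
  obtains x where "\<forall>i. x i \<ge> 0" "(\<Sum>i<n. (x i)\<^sup>2) > 0"
    "lambda1 A * (\<Sum>i<n. (x i)\<^sup>2) \<le> form A x x"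
proof -
  obtain v where "eigenvector A v (lambda1 A)"
    using lambda1_eigenvector[OF assms(1-3)] .
  then have v: "v \<in> carrier_vec n" "v \<noteq> 0\<^sub>v n" "A *\<^sub>v v = lambda1 A \<cdot>\<^sub>v v"
    using A by (auto simp: eigenvector_def)
  define x where "x = (\<lambda>i. \<bar>v $ i\<bar>)"
  obtain i where i: "i < n" "v $ i \<noteq> 0"
    using v(1,2) by (metis carrier_vecD eq_vecI index_zero_vec)
  have "(\<Sum>i<n. (x i)\<^sup>2) > 0"
    using i by (intro sum_pos2[of _ i]) (auto simp: x_def)
  moreover have "lambda1 A * (\<Sum>i<n. (x i)\<^sup>2) = form A (\<lambda>i. v $ i) (\<lambda>i. v $ i)"
    using v(1) by (simp add: form_mult_mat_vec[OF A(1) v(1)] v(3) x_def sum_distrib_left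
        power2_eq_square algebra_simps)
  moreover have "\<dots> \<le> form A x x"
    unfolding form_carrier[OF A(1)]
  proof (intro sum_mono)
    fix i j assume "i \<in> {..<n}" "j \<in> {..<n}"
    then have "A $$ (i, j) * (v $ i * v $ j) \<le> A $$ (i, j) * (x i * x j)"
      by (intro mult_left_mono nonneg) (auto simp: x_def abs_mult[symmetric])
    then show "A $$ (i, j) * v $ i * v $ j \<le> A $$ (i, j) * x i * x j"
      by (simp add: mult.assoc)
  qed
  ultimately show ?thesis using that[of x] by (simp add: x_def)
qed

section \<open>Adjacency matrices with prescribed row sums\<close>

lemma adjacency_matsD:
  assumes "A \<in> adjacency_mats D"
  shows "A \<in> carrier_mat (length D) (length D)" "A\<^sup>T = A"
    "\<And>i j. i < length D \<Longrightarrow> j < length D \<Longrightarrow> A $$ (i, j) = A $$ (j, i)"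
    "\<And>i j. i < length D \<Longrightarrow> j < length D \<Longrightarrow> A $$ (i, j) = 0 \<or> A $$ (i, j) = 1"
    "\<And>i. i < length D \<Longrightarrow> A $$ (i, i) = 0"
    "\<And>i. i < length D \<Longrightarrow> (\<Sum>j<length D. A $$ (i, j)) = real (D ! i)"
proof -
  show A: "A \<in> carrier_mat (length D) (length D)" "A\<^sup>T = A"
    using assms by (auto simp: adjacency_mats_def)
  show "A $$ (i, j) = A $$ (j, i)" if "i < length D" "j < length D" for i j
    using arg_cong[OF A(2), of "\<lambda>M. M $$ (i, j)"] that A(1) by auto
qed (use assms in \<open>auto simp: adjacency_mats_def\<close>)

lemma mat_in_adjacency_matsI:
  assumes "\<And>i j. i < length D \<Longrightarrow> j < length D \<Longrightarrow> f i j = f j i"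
    "\<And>i j. i < length D \<Longrightarrow> j < length D \<Longrightarrow> f i j = 0 \<or> f i j = 1"
    "\<And>i. i < length D \<Longrightarrow> f i i = 0"
    "\<And>i. i < length D \<Longrightarrow> (\<Sum>j<length D. f i j) = real (D ! i)"
  shows "mat (length D) (length D) (\<lambda>(i, j). f i j) \<in> adjacency_mats D"
  using assms unfolding adjacency_mats_def by (auto intro!: eq_matI)

lemma finite_adjacency_mats: "finite (adjacency_mats D)"
proof -
  let ?n = "length D"
  let ?F = "PiE ({..<?n} \<times> {..<?n}) (\<lambda>_. {0, 1::real})"
  have "adjacency_mats D \<subseteq> mat ?n ?n ` ?F"
  proof
    fix A assume A: "A \<in> adjacency_mats D"
    have "A = mat ?n ?n (restrict (($$) A) ({..<?n} \<times> {..<?n}))"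
      using adjacency_matsD(1)[OF A] by (intro eq_matI) auto
    moreover have "restrict (($$) A) ({..<?n} \<times> {..<?n}) \<in> ?F"
      using adjacency_matsD(4)[OF A] by auto
    ultimately show "A \<in> mat ?n ?n ` ?F" by blast
  qed
  moreover have "finite ?F" by (intro finite_PiE) auto
  ultimately show ?thesis by (meson finite_imageI finite_subset)
qed

text \<open>The witness is the adjacency matrix of \<open>H\<close>; this is where realizability of
  \<open>D\<close> enters.\<close>

lemma adjacency_mats_nonempty:
  assumes "pair_graph H" and "degree_sequence H D"
  shows "adjacency_mats D \<noteq> {}"
proof -
  interpret pair_graph H by fact
  have V: "pverts H = {..<length D}" and deg: "\<And>i. i < length D \<Longrightarrow> out_degree (with_proj H) i = D ! i"
    using assms(2) by (auto simp: degree_sequence_def)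
  have sym: "(i, j) \<in> parcs H \<longleftrightarrow> (j, i) \<in> parcs H" for i j
    using pair_sym_arcs by (auto simp: symmetric_def sym_def)
  have "mat (length D) (length D) (\<lambda>(i, j). of_bool ((i, j) \<in> parcs H)) \<in> adjacency_mats D"
  proof (rule mat_in_adjacency_matsI)
    fix i assume i: "i < length D"
    show "of_bool ((i, i) \<in> parcs H) = (0::real)" using pair_no_loops by force
    have "out_arcs (with_proj H) i = Pair i ` {j \<in> {..<length D}. (i, j) \<in> parcs H}"
      using arc_snd_in_verts V by (force simp: out_arcs_def)
    then have "D ! i = card {j \<in> {..<length D}. (i, j) \<in> parcs H}"
      using deg[OF i] by (simp add: out_degree_def card_image inj_on_def)
    then show "(\<Sum>j<length D. of_bool ((i, j) \<in> parcs H)) = real (D ! i)"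
      by (simp add: Int_def)
  qed (use sym in auto)
  then show ?thesis by blast
qed

section \<open>Sorting the test vector\<close>

text \<open>Conjugating by the transposition \<open>i \<leftrightarrow> j\<close> keeps the form but exchanges the degrees of \<open>i\<close>
  and \<open>j\<close>; moving \<open>D ! i - D ! j\<close> edges from \<open>j\<close> to \<open>i\<close> restores them and does not decrease
  the form.\<close>

lemma transpose_step:
  assumes A: "A \<in> adjacency_mats D" and ij: "i < j" "j < length D" and deg: "D ! j \<le> D ! i"
    and x: "\<forall>u. x u \<ge> 0" "x i < x j"
  obtains B where "B \<in> adjacency_mats D"
    "form A x x \<le> form B (x \<circ> transpose i j) (x \<circ> transpose i j)"
proof -
  let ?n = "length D" and ?T = "transpose i j"
  note Ad = adjacency_matsD[OF A]
  have i: "i < ?n" and neq: "i \<noteq> j" using ij by auto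
  have Tn: "?T u < ?n \<longleftrightarrow> u < ?n" for u using ij by (auto simp: transpose_def)
  have bij: "bij_betw ?T {..<?n} {..<?n}"
    using ij by (intro permutes_imp_bij permutes_swap_id) auto
  define N where "N u = {v \<in> {..<?n}. A $$ (u, v) = 1}" for u
  have cardN: "card (N u) = D ! u" if "u < ?n" for u
  proof -
    have "real (D ! u) = (\<Sum>v<?n. of_bool (A $$ (u, v) = 1))"
      unfolding Ad(6)[OF that, symmetric] using Ad(4)[OF that] by (intro sum.cong) auto
    then show ?thesis by (simp add: N_def Int_def)
  qed
  have fin: "finite (N u)" for u by (simp add: N_def)
  \<comment> \<open>There are enough vertices adjacent to \<open>i\<close> but not to
    \<open>j\<close>. If \<open>i\<close> and \<open>j\<close> are adjacent, removing each from the
    other's neighbourhood lowers both cardinalities by 1 and preserves their difference.\<close>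
  have "D ! i - D ! j \<le> card (N i - N j - {j})"
  proof (cases "j \<in> N i")
    case True
    then have "i \<in> N j" "i \<notin> N i"
      using Ad(3)[of i j] Ad(5)[of i] i ij(2) by (auto simp: N_def)
    then have "N i - N j - {j} = (N i - {j}) - (N j - {i})" by auto
    moreover have "card (N i - {j}) = D ! i - 1" "card (N j - {i}) = D ! j - 1" "0 < D ! j"
      using True \<open>i \<in> N j\<close> cardN i ij(2) fin
      by (auto simp: card_Diff_singleton card_gt_0_iff simp flip: cardN)
    moreover have "card (N i - {j}) - card (N j - {i}) \<le> card ((N i - {j}) - (N j - {i}))"
      by (intro diff_card_le_card_Diff) (use fin in auto)
    ultimately show ?thesis by simp
  next
    case False
    then have "N i - N j - {j} = N i - N j" by auto
    then show ?thesis
      using diff_card_le_card_Diff[OF fin, of "N i" j] cardN i ij(2) by simp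
  qed
  then obtain K where K: "K \<subseteq> N i - N j - {j}" "card K = D ! i - D ! j"
    by (meson obtain_subset_with_card_n)
  have "i \<notin> N i" using Ad(5)[OF i] by (simp add: N_def)
  then have K': "K \<subseteq> {..<?n}" "i \<notin> K" "j \<notin> K" using K(1) by (auto simp: N_def)
  have Ki: "A $$ (i, v) = 1" "A $$ (v, i) = 1" "A $$ (j, v) = 0" "A $$ (v, j) = 0" if "v \<in> K" for v
  proof -
    have v: "v < ?n" "v \<in> N i" "v \<notin> N j" using that K K' by auto
    then show "A $$ (i, v) = 1" "A $$ (j, v) = 0"
      using Ad(4)[OF ij(2) v(1)] by (auto simp: N_def)
    then show "A $$ (v, i) = 1" "A $$ (v, j) = 0"
      using Ad(3)[OF v(1)] i ij(2) by auto
  qed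
  \<comment> \<open>With \<open>e\<close> the difference of the unit vectors at \<open>i\<close> and
    \<open>j\<close>, and \<open>k\<close> the indicator of \<open>K\<close>, the symmetric matrix
    with entries \<open>e u * k v + k u * e v\<close> moves the edges to \<open>K\<close> from
    \<open>j\<close> to \<open>i\<close>. After conjugation the vertices of \<open>K\<close> are
    adjacent to \<open>j\<close> and not to \<open>i\<close>, so the result is again a 0-1
    matrix.\<close>
  define e :: "nat \<Rightarrow> real" where "e = (\<lambda>u. of_bool (u = i) - of_bool (u = j))"
  define k :: "nat \<Rightarrow> real" where "k = (\<lambda>u. of_bool (u \<in> K))"
  have sum_e: "(\<Sum>u<?n. e u * g u) = g i - g j" for g
    using i ij(2) by (simp add: e_def left_diff_distrib sum_subtractf of_bool_def if_distrib[of "\<lambda>c. c * _"] cong: if_cong)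
  have sum_k: "(\<Sum>u<?n. k u * g u) = (\<Sum>u\<in>K. g u)" for g
    unfolding k_def using K'(1) by (simp add: of_bool_def if_distrib[of "\<lambda>c. c * _"] sum.If_cases Int_absorb1 cong: if_cong)
  define f where "f u v = A $$ (?T u, ?T v) + e u * k v + k u * e v" for u v
  define B where "B = mat ?n ?n (\<lambda>(u, v). f u v)"
  have "B \<in> adjacency_mats D"
    unfolding B_def
  proof (rule mat_in_adjacency_matsI)
    fix u v assume u: "u < ?n" and v: "v < ?n"
    show "f u v = f v u"
      using Ad(3)[of "?T u" "?T v"] u v by (simp add: f_def Tn)
    show "f u v = 0 \<or> f u v = 1"
    proof (cases "u \<in> K \<and> v \<in> {i, j} \<or> v \<in> K \<and> u \<in> {i, j}")
      case True
      then show ?thesis using K' Ki neq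
        by (auto simp: f_def e_def k_def transpose_def)
    next
      case False
      then have "f u v = A $$ (?T u, ?T v)" by (auto simp: f_def e_def k_def)
      then show ?thesis using Ad(4)[of "?T u" "?T v"] u v by (simp add: Tn)
    qed
  next
    fix u assume u: "u < ?n"
    show "f u u = 0"
      using Ad(5)[of "?T u"] u K' by (auto simp: f_def Tn e_def k_def)
    have "(\<Sum>v<?n. A $$ (?T u, ?T v)) = (\<Sum>v<?n. A $$ (?T u, v))"
      by (rule sum.reindex_bij_betw[OF bij])
    also have "\<dots> = real (D ! ?T u)" using Ad(6) u Tn by simp
    finally have "(\<Sum>v<?n. f u v) = real (D ! ?T u) + e u * (\<Sum>v<?n. k v * 1) + k u * (\<Sum>v<?n. e v * 1)"
      by (simp add: f_def sum.distrib sum_distrib_left)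
    \<comment> \<open>The entries of \<open>e\<close> sum to 0 and those of \<open>k\<close> to
      \<open>card K\<close>, so only rows \<open>i\<close> and \<open>j\<close> are
      corrected.\<close>
    also have "\<dots> = real (D ! ?T u) + e u * (real (D ! i) - real (D ! j))"
      unfolding sum_e sum_k using K(2) deg by simp
    also have "\<dots> = real (D ! u)"
      using neq by (auto simp: e_def transpose_def)
    finally show "(\<Sum>v<?n. f u v) = real (D ! u)" .
  qed
  moreover have "form A x x \<le> form B (x \<circ> ?T) (x \<circ> ?T)"
  proof -
    let ?y = "x \<circ> ?T"
    have "form B ?y ?y = (\<Sum>u<?n. \<Sum>v<?n. f u v * ?y u * ?y v)"
      by (simp add: form_def B_def)
    also have "\<dots> = (\<Sum>u<?n. \<Sum>v<?n. A $$ (?T u, ?T v) * x (?T u) * x (?T v))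
       + (\<Sum>u<?n. e u * ?y u) * (\<Sum>v<?n. k v * ?y v) + (\<Sum>u<?n. k u * ?y u) * (\<Sum>v<?n. e v * ?y v)"
    proof -
      have "f u v * ?y u * ?y v = A $$ (?T u, ?T v) * x (?T u) * x (?T v)
          + (e u * ?y u) * (k v * ?y v) + (k u * ?y u) * (e v * ?y v)" for u v
        by (simp add: f_def algebra_simps)
      then show ?thesis by (simp only: sum.distrib sum_product)
    qed
    also have "(\<Sum>u<?n. \<Sum>v<?n. A $$ (?T u, ?T v) * x (?T u) * x (?T v)) = 
        (\<Sum>u<?n. \<Sum>v<?n. A $$ (?T u, v) * x (?T u) * x v)"
      by (intro sum.cong refl sum.reindex_bij_betw[OF bij, of "\<lambda>v. A $$ (_, v) * x _ * x v"])
    also have "\<dots> = (\<Sum>u<?n. \<Sum>v<?n. A $$ (u, v) * x u * x v)"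
      by (rule sum.reindex_bij_betw[OF bij, of "\<lambda>u. \<Sum>v<?n. A $$ (u, v) * x u * x v"])
    also have "\<dots> = form A x x"
      by (simp add: form_carrier[OF Ad(1)])
    \<comment> \<open>The correction contributes twice the product of the pairings of
      \<open>?y\<close> with \<open>e\<close> and \<open>k\<close>; the former is
      \<open>?y i - ?y j = x j - x i\<close>.\<close>
    finally have "form B ?y ?y = form A x x + 2 * ((x j - x i) * (\<Sum>v\<in>K. ?y v))"
      unfolding sum_e sum_k by (simp add: comp_def)
    moreover have "0 \<le> (x j - x i) * (\<Sum>v\<in>K. ?y v)"
      using x by (intro mult_nonneg_nonneg sum_nonneg) auto
    ultimately show ?thesis by simp
  qed
  ultimately show ?thesis using that by blast
qed

text \<open>The exchange lowers the weighted sum by \<open>(j - i) * (x j - x i)\<close>; this sum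
  is the potential that drives the sorting.\<close>

lemma sum_transpose_less:
  fixes x :: "nat \<Rightarrow> real"
  assumes "i < j" "j < n" "x i < x j"
  shows "(\<Sum>u<n. real u * (x \<circ> transpose i j) u) < (\<Sum>u<n. real u * x u)"
proof -
  have split: "(\<Sum>u<n. real u * g u) = real i * g i + (real j * g j + (\<Sum>u\<in>{..<n} - {i} - {j}. real u * g u))"
    for g :: "nat \<Rightarrow> real"
    using assms(1,2) by (simp add: sum.remove[of "{..<n}" i] sum.remove[of "{..<n} - {i}" j])
  moreover have "(\<Sum>u\<in>{..<n} - {i} - {j}. real u * (x \<circ> transpose i j) u)
      = (\<Sum>u\<in>{..<n} - {i} - {j}. real u * x u)"
    by (intro sum.cong) (auto simp: transpose_def)
  moreover have "0 < (real j - real i) * (x j - x i)"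
    using assms by simp
  ultimately show ?thesis unfolding split by (simp add: algebra_simps)
qed

text \<open>Among the rearrangements of \<open>x\<close> that some matrix pairs with a form value of
  at least \<open>form A x x\<close>, one with least potential is sorted: at an inversion,
  \<open>transpose_step\<close> would yield a smaller potential. The order of \<open>D\<close>
  supplies the degree condition of that step.\<close>

lemma exists_sorted_vector:
  assumes A: "A \<in> adjacency_mats D" and D: "sorted_wrt (\<ge>) D" and x: "\<forall>u. x u \<ge> 0"
  obtains B y where "B \<in> adjacency_mats D" "form A x x \<le> form B y y"
    "(\<Sum>u<length D. (y u)\<^sup>2) = (\<Sum>u<length D. (x u)\<^sup>2)"
    "\<forall>i j. i < j \<longrightarrow> j < length D \<longrightarrow> y j \<le> y i"
proof -
  let ?n = "length D"
  \<comment> \<open>Recording permutations instead of the rearranged vectors makes finiteness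
    immediate.\<close>
  define P where "P = {(B, p). B \<in> adjacency_mats D \<and> p permutes {..<?n}
    \<and> form A x x \<le> form B (x \<circ> p) (x \<circ> p)}"
  define \<Phi> where "\<Phi> = (\<lambda>(B :: real mat, p). \<Sum>u<?n. real u * (x \<circ> p) u)"
  have "P \<subseteq> adjacency_mats D \<times> {p. p permutes {..<?n}}" by (auto simp: P_def)
  then have "finite P"
    by (rule finite_subset) (intro finite_cartesian_product finite_adjacency_mats finite_permutations finite_lessThan)
  moreover have "(A, id) \<in> P" using A by (auto simp: P_def permutes_id)
  ultimately obtain q where q: "q \<in> P" "\<And>r. r \<in> P \<Longrightarrow> - \<Phi> r \<le> - \<Phi> q"
    using finite_maximizer[of P "\<lambda>q. - \<Phi> q"] by blast
  obtain B p where qB: "q = (B, p)" by (cases q)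
  with q(1) have B: "B \<in> adjacency_mats D" "p permutes {..<?n}" "form A x x \<le> form B (x \<circ> p) (x \<circ> p)"
    by (auto simp: P_def)
  have "(x \<circ> p) j \<le> (x \<circ> p) i" if ij: "i < j" "j < ?n" for i j
  proof (rule ccontr)
    assume "\<not> (x \<circ> p) j \<le> (x \<circ> p) i"
    then have less: "(x \<circ> p) i < (x \<circ> p) j" by simp
    have "D ! j \<le> D ! i" using D ij by (rule sorted_wrt_nth_less)
    moreover have "\<forall>u. 0 \<le> (x \<circ> p) u" using x by simp
    ultimately obtain C where C: "C \<in> adjacency_mats D"
      "form B (x \<circ> p) (x \<circ> p) \<le> form C (x \<circ> p \<circ> transpose i j) (x \<circ> p \<circ> transpose i j)"
      using transpose_step[OF B(1) ij _ _ less] by blast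
    have "p \<circ> transpose i j permutes {..<?n}"
      using ij B(2) by (intro permutes_compose permutes_swap_id) auto
    with B(3) C have "(C, p \<circ> transpose i j) \<in> P" by (auto simp: P_def comp_assoc)
    from q(2)[OF this] sum_transpose_less[OF ij less] show False
      by (simp add: \<Phi>_def qB comp_assoc)
  qed
  moreover have "(\<Sum>u<?n. ((x \<circ> p) u)\<^sup>2) = (\<Sum>u<?n. (x u)\<^sup>2)"
    using sum.permute[OF B(2), of "\<lambda>u. (x u)\<^sup>2"] by (simp add: comp_def)
  ultimately show ?thesis using that[of B "x \<circ> p"] B by blast
qed

section \<open>Positive switches and sinks\<close>

lemma switch_mat_carrier: "switch_mat n i j k l \<in> carrier_mat n n"
  by (simp add: switch_mat_def)

text \<open>The switch matrix is a symmetrized outer product of two differences of unit vectors, one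
  for \<open>i\<close> and \<open>j\<close>, one for \<open>k\<close> and \<open>l\<close>, so its
  form factors.\<close>

lemma form_switch_mat:
  assumes "distinct [i, j, k, l]" "{i, j, k, l} \<subseteq> {..<n}"
  shows "form (switch_mat n i j k l) x x = 2 * (x i - x j) * (x k - x l)"
proof -
  define d :: "nat \<Rightarrow> nat \<Rightarrow> real" where "d a u = of_bool (u = a)" for a u
  have sum_d: "(\<Sum>u<n. d a u * g u) = g a" if "a < n" for a g
    using that by (simp add: d_def of_bool_def if_distrib[of "\<lambda>c. c * _"] cong: if_cong)
  let ?e = "\<lambda>u. d i u - d j u" and ?h = "\<lambda>u. d k u - d l u"
  have *: "switch_mat n i j k l $$ (u, v) = ?e u * ?h v + ?h u * ?e v" if "u < n" "v < n" for u v
  proof -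
    have "u \<notin> {i, j, k, l} \<or> u = i \<or> u = j \<or> u = k \<or> u = l"
      "v \<notin> {i, j, k, l} \<or> v = i \<or> v = j \<or> v = k \<or> v = l" by auto
    then show ?thesis
      using that assms(1) by (elim disjE) (simp_all add: switch_mat_def d_def)
  qed
  have "form (switch_mat n i j k l) x x
      = (\<Sum>u<n. \<Sum>v<n. (?e u * x u) * (?h v * x v) + (?h u * x u) * (?e v * x v))"
    unfolding form_carrier[of _ n n, OF switch_mat_carrier]
    by (intro sum.cong refl) (simp only: * lessThan_iff, simp add: algebra_simps)
  also have "\<dots> = (\<Sum>u<n. ?e u * x u) * (\<Sum>v<n. ?h v * x v)
      + (\<Sum>u<n. ?h u * x u) * (\<Sum>v<n. ?e v * x v)"
    by (simp only: sum.distrib sum_product)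
  also have "(\<Sum>u<n. ?e u * x u) = x i - x j"
    using assms(2) by (simp add: left_diff_distrib sum_subtractf sum_d)
  also have "(\<Sum>u<n. ?h u * x u) = x k - x l"
    using assms(2) by (simp add: left_diff_distrib sum_subtractf sum_d)
  also have "(x i - x j) * (x k - x l) + (x k - x l) * (x i - x j) = 2 * (x i - x j) * (x k - x l)"
    by simp
  finally show ?thesis .
qed

text \<open>For a non-increasing \<open>y\<close> a positive switch does not decrease the form, and for the strictly
  decreasing \<open>y i = - i\<close> it increases it; the latter makes the switch graph acyclic.\<close>

lemma exists_sink_form_ge:
  assumes B: "B \<in> adjacency_mats D" and y: "\<forall>i j. i < j \<longrightarrow> j < length D \<longrightarrow> y j \<le> y i"
  obtains A where "is_sink (switch_graph D) A" "A \<in> adjacency_mats D" "form B y y \<le> form A y y"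
proof -
  define S where "S = {A \<in> adjacency_mats D. form B y y \<le> form A y y}"
  define \<Psi> where "\<Psi> A = form A (\<lambda>i. - real i) (\<lambda>i. - real i)" for A
  have "finite S" "B \<in> S" using finite_adjacency_mats B by (auto simp: S_def)
  then obtain A where A: "A \<in> S" "\<And>C. C \<in> S \<Longrightarrow> \<Psi> C \<le> \<Psi> A"
    using finite_maximizer[of S \<Psi>] by blast
  have "\<not> positive_switch D A C" for C
  proof
    assume "positive_switch D A C"
    then obtain i j k l where C: "C \<in> adjacency_mats D" "C = A + switch_mat (length D) i j k l"
      and ijkl: "distinct [i, j, k, l]" "{i, j, k, l} \<subseteq> {..<length D}" "i < j" "k < l"
      by (auto simp: positive_switch_def)
    have carr: "A \<in> carrier_mat (length D) (length D)"
      using A(1) adjacency_matsD(1) by (auto simp: S_def)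
    have form_C: "form C z z = form A z z + 2 * (z i - z j) * (z k - z l)" for z
      unfolding C(2) by (simp add: form_add_mat[OF carr switch_mat_carrier]
          form_switch_mat[OF ijkl(1,2)])
    have "0 \<le> 2 * (y i - y j) * (y k - y l)"
      using y ijkl by (intro mult_nonneg_nonneg) auto
    with form_C[of y] A(1) C(1) have "C \<in> S" by (auto simp: S_def)
    moreover have "\<Psi> A < \<Psi> C"
      unfolding \<Psi>_def form_C using ijkl(3,4) by (simp add: zero_less_mult_iff)
    ultimately show False using A(2) by (meson not_le)
  qed
  then have "is_sink (switch_graph D) A"
    using A(1) by (auto simp: is_sink_def switch_graph_def out_arcs_def S_def)
  then show ?thesis using that A(1) by (auto simp: S_def)
qed

theorem theorem4:
  fixes D :: "nat list" and H :: "nat pair_pre_digraph"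
  assumes "pair_graph H" and "degree_sequence H D"
    and "sorted_wrt (\<ge>) D"
  shows "\<exists>A. is_sink (switch_graph D) A \<and> (\<forall>B \<in> adjacency_mats D. lambda1 B \<le> lambda1 A)"
proof -
  let ?n = "length D"
  obtain M where M: "M \<in> adjacency_mats D" "\<And>B. B \<in> adjacency_mats D \<Longrightarrow> lambda1 B \<le> lambda1 M"
    using finite_maximizer[OF finite_adjacency_mats adjacency_mats_nonempty[OF assms(1,2)]] by blast
  show ?thesis
  proof (cases "?n = 0")
    \<comment> \<open>In dimension 0 \<open>lambda1\<close> is unspecified, but there is only one
      matrix to compare. The zero vector merely serves to obtain a sink.\<close>
    case True
    obtain A where A: "is_sink (switch_graph D) A" "A \<in> adjacency_mats D"
      using exists_sink_form_ge[OF M(1), of "\<lambda>_. 0"] by auto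
    have "B = A" if "B \<in> adjacency_mats D" for B
      using adjacency_matsD(1)[OF that] adjacency_matsD(1)[OF A(2)] True by (intro eq_matI) auto
    then have "lambda1 B \<le> lambda1 A" if "B \<in> adjacency_mats D" for B using that by blast
    with A(1) show ?thesis by blast
  next
    case False
    then have n: "0 < ?n" by simp
    note Md = adjacency_matsD[OF M(1)]
    have nonneg: "M $$ (i, j) \<ge> 0" if "i < ?n" "j < ?n" for i j using Md(4)[OF that] by auto
    obtain x where x: "\<forall>i. x i \<ge> 0" "(\<Sum>i<?n. (x i)\<^sup>2) > 0"
      "lambda1 M * (\<Sum>i<?n. (x i)\<^sup>2) \<le> form M x x"
      using nonneg_vector_form_ge_lambda1[OF Md(1,2) n nonneg] .
    obtain B y where B: "B \<in> adjacency_mats D" "form M x x \<le> form B y y"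
      "(\<Sum>u<?n. (y u)\<^sup>2) = (\<Sum>u<?n. (x u)\<^sup>2)" "\<forall>i j. i < j \<longrightarrow> j < ?n \<longrightarrow> y j \<le> y i"
      by (rule exists_sorted_vector[OF M(1) assms(3) x(1)])
    obtain A where A: "is_sink (switch_graph D) A" "A \<in> adjacency_mats D" "form B y y \<le> form A y y"
      by (rule exists_sink_form_ge[OF B(1,4)])
    \<comment> \<open>The form values increase along \<open>M\<close>, \<open>B\<close>,
      \<open>A\<close>; Rayleigh's bound for \<open>A\<close> at \<open>y\<close> closes the chain,
      as \<open>y\<close> and \<open>x\<close> have the same positive norm.\<close>
    have "lambda1 M * (\<Sum>i<?n. (x i)\<^sup>2) \<le> lambda1 A * (\<Sum>i<?n. (x i)\<^sup>2)"
      using x(3) B(2,3) A(3) form_le_lambda1[OF adjacency_matsD(1,2)[OF A(2)] n, of y] by simp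
    then have "lambda1 M \<le> lambda1 A" using x(2) by simp
    then have "lambda1 B \<le> lambda1 A" if "B \<in> adjacency_mats D" for B
      using M(2)[OF that] by linarith
    with A(1) show ?thesis by blast
  qed
qed

end
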